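(* Let $(M,J,g)$ be an $(\alpha,\varepsilon)$-metric manifold with $\alpha=-1$, and let $\phi(\cdot,\cdot)=g(J\cdot,\cdot)$ be its fundamental tensor. On $\mathbb TM=TM\oplus T^*M$ put, for $b\in\{g,\phi\}$ and $\lambda\in\{+1,-1\}$, $$\mathcal J_b=\begin{pmatrix}0&-\sharp_b\\ \flat_b&0\end{pmatrix},\quad \mathcal F_b=\begin{pmatrix}0&\sharp_b\\ \flat_b&0\end{pmatrix},\quad \mathcal J_{\lambda,J}=\begin{pmatrix}J&0\\0&\lambda J^*\end{pmatrix}.$$ Then the following are generalized triple structures: $(\mathcal J_g,\mathcal J_{\varepsilon,J},\mathcal J_\phi)$ is a generalized almost hypercomplex structure; $(\mathcal J_g,\mathcal J_{-\varepsilon,J},\mathcal F_\phi)$ is a generalized almost bicomplex structure; $(\mathcal J_\phi,\mathcal J_{-\varepsilon,J},-\mathcal F_g)$ is a generalized almost bicomplex structure; and $(\mathcal F_g,\mathcal F_\phi,\mathcal J_{\varepsilon,J})$ is a generalized almost biparacomplex structure.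
   Context: An $(\alpha,\varepsilon)$-metric manifold $(M,J,g)$, $\alpha,\varepsilon\in\{+1,-1\}$, is a smooth manifold with a Riemannian or pseudo-Riemannian metric $g$ and an $\mathfrak F(M)$-linear $J\colon\mathfrak X(M)\to\mathfrak X(M)$ with $J^2=\alpha Id$ and $g(JX,JY)=\varepsilon g(X,Y)$ for all $X,Y$. $\mathfrak F(M)$, $\mathfrak X(M)$, $\Lambda^1(M)$ denote smooth functions, vector fields, 1-forms; sections of $\mathbb TM$ are written $X+\xi$. For a nondegenerate bilinear form $b$ on $M$: $(\flat_bX)(Y)=b(X,Y)$, $\sharp_b=\flat_b^{-1}$. $(J^*\xi)(X)=\xi(JX)$. Matrix notation: $\begin{pmatrix}H&\sigma\\ \tau&K\end{pmatrix}(X+\xi)=(HX+\sigma\xi)+(\tau X+K\xi)$. A generalized triple structure $(\mathcal A,\mathcal B,\mathcal C)$ consists of $\mathfrak F(M)$-linear endomorphisms of $\Gamma(\mathbb TM)$, each with square $Id$ (almost product) or $-Id$ (almost complex), such that $\mathcal B\mathcal A=\pm\mathcal A\mathcal B$ and $\mathcal C=\mathcal A\mathcal B$. It is generalized almost hypercomplex if $\mathcal A^2=\mathcal B^2=\mathcal C^2=-Id$ and the three pairwise anti-commute; generalized almost bicomplex if $\mathcal A^2=\mathcal B^2=-Id$, $\mathcal C^2=Id$ and the three pairwise commute; generalized almost biparacomplex if $\mathcal A^2=\mathcal B^2=Id$, $\mathcal C^2=-Id$ and the three pairwise anti-commute. *)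

theory Defs
  imports "HOL-Analysis.Analysis" "HOL-Library.Function_Algebras"
begin

instantiation "fun" :: (type, real_vector) real_vector
begin

definition scaleR_fun :: "real \<Rightarrow> ('a \<Rightarrow> 'b) \<Rightarrow> 'a \<Rightarrow> 'b"
  where "scaleR_fun r f = (\<lambda>x. r *\<^sub>R f x)"

instance
  by standard (auto simp: scaleR_fun_def fun_eq_iff scaleR_add_right scaleR_add_left)

end


section \<open>Smooth manifolds\<close>

text \<open>Both notions below are only meant for open \<open>S\<close>.\<close>

primrec C_k_on :: "nat \<Rightarrow> 'a::real_normed_vector set \<Rightarrow> ('a \<Rightarrow> 'b::real_normed_vector) \<Rightarrow> bool"
  where
    "C_k_on 0 S f \<longleftrightarrow> continuous_on S f"
  | "C_k_on (Suc k) S f \<longleftrightarrow>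
       (\<forall>x\<in>S. f differentiable (at x)) \<and>
       (\<forall>v. C_k_on k S (\<lambda>x. frechet_derivative f (at x) v))"

definition smooth_on :: "'a::real_normed_vector set \<Rightarrow> ('a \<Rightarrow> 'b::real_normed_vector) \<Rightarrow> bool"
  where "smooth_on S f \<longleftrightarrow> (\<forall>k. C_k_on k S f)"

text \<open>The underlying set of the manifold is the type \<open>'a\<close>, the dimension is \<open>CARD('n)\<close>. A chart
  is a pair of its domain and its coordinate map (irrelevant outside the domain).\<close>

type_synonym ('a, 'n) chart = "'a set \<times> ('a \<Rightarrow> real ^ 'n)"

definition chart_inv :: "('a, 'n::finite) chart \<Rightarrow> real ^ 'n \<Rightarrow> 'a"
  where "chart_inv c = inv_into (fst c) (snd c)"

definition chart_range :: "('a, 'n::finite) chart \<Rightarrow> (real ^ 'n) set"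
  where "chart_range c = snd c ` fst c"

definition is_chart :: "('a::topological_space, 'n::finite) chart \<Rightarrow> bool"
  where "is_chart c \<longleftrightarrow>
    open (fst c) \<and> open (chart_range c) \<and>
    homeomorphism (fst c) (chart_range c) (snd c) (chart_inv c)"

definition transition :: "('a, 'n::finite) chart \<Rightarrow> ('a, 'n) chart \<Rightarrow> real ^ 'n \<Rightarrow> real ^ 'n"
  where "transition c d = snd d \<circ> chart_inv c"

definition smooth_manifold ::
    "('a::{t2_space, second_countable_topology}, 'n::finite) chart set \<Rightarrow> bool"
  where "smooth_manifold \<A> \<longleftrightarrow>
    (\<forall>c\<in>\<A>. is_chart c) \<and>
    (\<Union>c\<in>\<A>. fst c) = UNIV \<and>
    (\<forall>c\<in>\<A>. \<forall>d\<in>\<A>. smooth_on (snd c ` (fst c \<inter> fst d)) (transition c d))"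

definition smooth_functions :: "('a, 'n::finite) chart set \<Rightarrow> ('a \<Rightarrow> real) set"
  where "smooth_functions \<A> = {f. \<forall>c\<in>\<A>. smooth_on (chart_range c) (f \<circ> chart_inv c)}"

text \<open>A tangent vector at \<open>p\<close> is given by its components with respect to all charts around \<open>p\<close>,
  which are related by the Jacobians of the transition maps. At all other arguments it is \<open>0\<close>, so
  that equality of tangent vectors is equality of functions.\<close>

type_synonym ('a, 'n) tvec = "('a, 'n) chart \<Rightarrow> real ^ 'n"

definition tangent_space :: "('a, 'n::finite) chart set \<Rightarrow> 'a \<Rightarrow> ('a, 'n) tvec set"
  where "tangent_space \<A> p = {v.
    (\<forall>c. c \<notin> \<A> \<or> p \<notin> fst c \<longrightarrow> v c = 0) \<and>
    (\<forall>c\<in>\<A>. \<forall>d\<in>\<A>. p \<in> fst c \<and> p \<in> fst d \<longrightarrow>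
       v d = frechet_derivative (transition c d) (at (snd c p)) (v c))}"

text \<open>The coordinate tangent vector \<open>\<partial>/\<partial>x\<^sup>i\<close> of the chart \<open>c\<close> at \<open>p\<close>.\<close>

definition coord_vec :: "('a, 'n::finite) chart set \<Rightarrow> ('a, 'n) chart \<Rightarrow> 'n \<Rightarrow> 'a \<Rightarrow> ('a, 'n) tvec"
  where "coord_vec \<A> c i p =
    (\<lambda>d. if d \<in> \<A> \<and> p \<in> fst d
         then frechet_derivative (transition c d) (at (snd c p)) (axis i 1) else 0)"

type_synonym ('a, 'n) vfield = "'a \<Rightarrow> ('a, 'n) tvec"

definition vector_fields :: "('a, 'n::finite) chart set \<Rightarrow> ('a, 'n) vfield set"
  where "vector_fields \<A> = {X.
    (\<forall>p. X p \<in> tangent_space \<A> p) \<and>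
    (\<forall>c\<in>\<A>. smooth_on (chart_range c) (\<lambda>x. X (chart_inv c x) c))}"

text \<open>Linear forms on a tangent space are extended by \<open>0\<close> to the whole type.\<close>

definition cotangent_space ::
    "('a, 'n::finite) chart set \<Rightarrow> 'a \<Rightarrow> (('a, 'n) tvec \<Rightarrow> real) set"
  where "cotangent_space \<A> p = {w.
    (\<forall>u\<in>tangent_space \<A> p. \<forall>v\<in>tangent_space \<A> p. w (u + v) = w u + w v) \<and>
    (\<forall>a. \<forall>v\<in>tangent_space \<A> p. w (a *\<^sub>R v) = a * w v) \<and>
    (\<forall>v. v \<notin> tangent_space \<A> p \<longrightarrow> w v = 0)}"

type_synonym ('a, 'n) oneform = "'a \<Rightarrow> ('a, 'n) tvec \<Rightarrow> real"

definition one_forms :: "('a, 'n::finite) chart set \<Rightarrow> ('a, 'n) oneform set"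
  where "one_forms \<A> = {\<xi>.
    (\<forall>p. \<xi> p \<in> cotangent_space \<A> p) \<and>
    (\<forall>c\<in>\<A>. \<forall>i. smooth_on (chart_range c)
       (\<lambda>x. \<xi> (chart_inv c x) (coord_vec \<A> c i (chart_inv c x))))}"

definition form_app :: "('a, 'n::finite) oneform \<Rightarrow> ('a, 'n) vfield \<Rightarrow> 'a \<Rightarrow> real"
  where "form_app \<xi> X = (\<lambda>p. \<xi> p (X p))"

text \<open>Module multiplication by functions, for vector fields as well as for 1-forms.\<close>

definition fscale :: "('a \<Rightarrow> real) \<Rightarrow> ('a \<Rightarrow> 'b::real_vector) \<Rightarrow> 'a \<Rightarrow> 'b"
  where "fscale f X = (\<lambda>p. f p *\<^sub>R X p)"


section \<open>\<open>(\<alpha>,\<epsilon>)\<close>-metric manifolds\<close>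

type_synonym ('a, 'n) tensor02 = "'a \<Rightarrow> ('a, 'n) tvec \<Rightarrow> ('a, 'n) tvec \<Rightarrow> real"

text \<open>Nondegeneracy is required at every point; Riemannian metrics are the positive definite case.\<close>

definition pseudo_Riemannian_metric ::
    "('a, 'n::finite) chart set \<Rightarrow> ('a, 'n) tensor02 \<Rightarrow> bool"
  where "pseudo_Riemannian_metric \<A> g \<longleftrightarrow>
    (\<forall>p. \<forall>u\<in>tangent_space \<A> p. \<forall>v\<in>tangent_space \<A> p. \<forall>w\<in>tangent_space \<A> p.
       g p (u + v) w = g p u w + g p v w) \<and>
    (\<forall>p a. \<forall>u\<in>tangent_space \<A> p. \<forall>v\<in>tangent_space \<A> p. g p (a *\<^sub>R u) v = a * g p u v) \<and>
    (\<forall>p. \<forall>u\<in>tangent_space \<A> p. \<forall>v\<in>tangent_space \<A> p. g p u v = g p v u) \<and>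
    (\<forall>p. \<forall>u\<in>tangent_space \<A> p. (\<forall>v\<in>tangent_space \<A> p. g p u v = 0) \<longrightarrow> u = 0) \<and>
    (\<forall>c\<in>\<A>. \<forall>i j. smooth_on (chart_range c)
       (\<lambda>x. g (chart_inv c x) (coord_vec \<A> c i (chart_inv c x))
                              (coord_vec \<A> c j (chart_inv c x))))"

type_synonym ('a, 'n) bilin = "('a, 'n) vfield \<Rightarrow> ('a, 'n) vfield \<Rightarrow> 'a \<Rightarrow> real"

definition on_fields :: "('a, 'n::finite) tensor02 \<Rightarrow> ('a, 'n) bilin"
  where "on_fields g X Y = (\<lambda>p. g p (X p) (Y p))"

definition vfield_endomorphism ::
    "('a, 'n::finite) chart set \<Rightarrow> (('a, 'n) vfield \<Rightarrow> ('a, 'n) vfield) \<Rightarrow> bool"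
  where "vfield_endomorphism \<A> J \<longleftrightarrow>
    (\<forall>X\<in>vector_fields \<A>. J X \<in> vector_fields \<A>) \<and>
    (\<forall>X\<in>vector_fields \<A>. \<forall>Y\<in>vector_fields \<A>. J (X + Y) = J X + J Y) \<and>
    (\<forall>f\<in>smooth_functions \<A>. \<forall>X\<in>vector_fields \<A>. J (fscale f X) = fscale f (J X))"

definition metric_manifold ::
    "real \<Rightarrow> real \<Rightarrow> ('a::{t2_space, second_countable_topology}, 'n::finite) chart set \<Rightarrow>
     (('a, 'n) vfield \<Rightarrow> ('a, 'n) vfield) \<Rightarrow> ('a, 'n) tensor02 \<Rightarrow> bool"
  where "metric_manifold \<alpha> \<epsilon> \<A> J g \<longleftrightarrow>
    \<alpha> \<in> {1, - 1} \<and> \<epsilon> \<in> {1, - 1} \<and>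
    smooth_manifold \<A> \<and> pseudo_Riemannian_metric \<A> g \<and> vfield_endomorphism \<A> J \<and>
    (\<forall>X\<in>vector_fields \<A>. J (J X) = \<alpha> *\<^sub>R X) \<and>
    (\<forall>X\<in>vector_fields \<A>. \<forall>Y\<in>vector_fields \<A>.
       on_fields g (J X) (J Y) = \<epsilon> *\<^sub>R on_fields g X Y)"

definition fundamental_tensor ::
    "(('a, 'n::finite) vfield \<Rightarrow> ('a, 'n) vfield) \<Rightarrow> ('a, 'n) tensor02 \<Rightarrow> ('a, 'n) bilin"
  where "fundamental_tensor J g X Y = on_fields g (J X) Y"

text \<open>A 1-form is determined by its values on all global vector fields; this is how
  \<open>\<flat>\<^sub>b X\<close> and \<open>J\<^sup>* \<xi>\<close> are specified.\<close>

definition flat ::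
    "('a, 'n::finite) chart set \<Rightarrow> ('a, 'n) bilin \<Rightarrow> ('a, 'n) vfield \<Rightarrow> ('a, 'n) oneform"
  where "flat \<A> b X =
    (THE \<xi>. \<xi> \<in> one_forms \<A> \<and> (\<forall>Y\<in>vector_fields \<A>. form_app \<xi> Y = b X Y))"

definition sharp ::
    "('a, 'n::finite) chart set \<Rightarrow> ('a, 'n) bilin \<Rightarrow> ('a, 'n) oneform \<Rightarrow> ('a, 'n) vfield"
  where "sharp \<A> b = the_inv_into (vector_fields \<A>) (flat \<A> b)"

definition dual_map ::
    "('a, 'n::finite) chart set \<Rightarrow> (('a, 'n) vfield \<Rightarrow> ('a, 'n) vfield) \<Rightarrow>
     ('a, 'n) oneform \<Rightarrow> ('a, 'n) oneform"
  where "dual_map \<A> J \<xi> =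
    (THE \<eta>. \<eta> \<in> one_forms \<A> \<and> (\<forall>X\<in>vector_fields \<A>. form_app \<eta> X = form_app \<xi> (J X)))"


section \<open>Structures on the generalized tangent bundle\<close>

text \<open>The section \<open>X + \<xi>\<close> of \<open>TM \<oplus> T\<^sup>*M\<close> is represented by the pair \<open>(X, \<xi>)\<close>.\<close>

type_synonym ('a, 'n) gsection = "('a, 'n) vfield \<times> ('a, 'n) oneform"

definition gsections :: "('a, 'n::finite) chart set \<Rightarrow> ('a, 'n) gsection set"
  where "gsections \<A> = vector_fields \<A> \<times> one_forms \<A>"

definition block_map ::
    "(('a, 'n::finite) vfield \<Rightarrow> ('a, 'n) vfield) \<Rightarrow> (('a, 'n) oneform \<Rightarrow> ('a, 'n) vfield) \<Rightarrow>
     (('a, 'n) vfield \<Rightarrow> ('a, 'n) oneform) \<Rightarrow> (('a, 'n) oneform \<Rightarrow> ('a, 'n) oneform) \<Rightarrow>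
     ('a, 'n) gsection \<Rightarrow> ('a, 'n) gsection"
  where "block_map H \<sigma> \<tau> K = (\<lambda>(X, \<xi>). (H X + \<sigma> \<xi>, \<tau> X + K \<xi>))"

definition gen_J ::
    "('a, 'n::finite) chart set \<Rightarrow> ('a, 'n) bilin \<Rightarrow> ('a, 'n) gsection \<Rightarrow> ('a, 'n) gsection"
  where "gen_J \<A> b = block_map (\<lambda>_. 0) (\<lambda>\<xi>. - sharp \<A> b \<xi>) (flat \<A> b) (\<lambda>_. 0)"

definition gen_F ::
    "('a, 'n::finite) chart set \<Rightarrow> ('a, 'n) bilin \<Rightarrow> ('a, 'n) gsection \<Rightarrow> ('a, 'n) gsection"
  where "gen_F \<A> b = block_map (\<lambda>_. 0) (sharp \<A> b) (flat \<A> b) (\<lambda>_. 0)"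

definition gen_diag ::
    "('a, 'n::finite) chart set \<Rightarrow> real \<Rightarrow> (('a, 'n) vfield \<Rightarrow> ('a, 'n) vfield) \<Rightarrow>
     ('a, 'n) gsection \<Rightarrow> ('a, 'n) gsection"
  where "gen_diag \<A> l J = block_map J (\<lambda>_. 0) (\<lambda>_. 0) (\<lambda>\<xi>. l *\<^sub>R dual_map \<A> J \<xi>)"

type_synonym ('a, 'n) gmap = "('a, 'n) gsection \<Rightarrow> ('a, 'n) gsection"

definition gen_endomorphism :: "('a, 'n::finite) chart set \<Rightarrow> ('a, 'n) gmap \<Rightarrow> bool"
  where "gen_endomorphism \<A> P \<longleftrightarrow>
    (\<forall>s\<in>gsections \<A>. P s \<in> gsections \<A>) \<and>
    (\<forall>s\<in>gsections \<A>. \<forall>t\<in>gsections \<A>. P (s + t) = P s + P t) \<and>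
    (\<forall>f\<in>smooth_functions \<A>. \<forall>s\<in>gsections \<A>.
       P (map_prod (fscale f) (fscale f) s) = map_prod (fscale f) (fscale f) (P s))"

definition gen_almost_product :: "('a, 'n::finite) chart set \<Rightarrow> ('a, 'n) gmap \<Rightarrow> bool"
  where "gen_almost_product \<A> P \<longleftrightarrow>
    gen_endomorphism \<A> P \<and> (\<forall>s\<in>gsections \<A>. P (P s) = s)"

definition gen_almost_complex :: "('a, 'n::finite) chart set \<Rightarrow> ('a, 'n) gmap \<Rightarrow> bool"
  where "gen_almost_complex \<A> P \<longleftrightarrow>
    gen_endomorphism \<A> P \<and> (\<forall>s\<in>gsections \<A>. P (P s) = - s)"

definition gcommute :: "('a, 'n::finite) chart set \<Rightarrow> ('a, 'n) gmap \<Rightarrow> ('a, 'n) gmap \<Rightarrow> bool"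
  where "gcommute \<A> P Q \<longleftrightarrow> (\<forall>s\<in>gsections \<A>. Q (P s) = P (Q s))"

definition ganticommute :: "('a, 'n::finite) chart set \<Rightarrow> ('a, 'n) gmap \<Rightarrow> ('a, 'n) gmap \<Rightarrow> bool"
  where "ganticommute \<A> P Q \<longleftrightarrow> (\<forall>s\<in>gsections \<A>. Q (P s) = - P (Q s))"

definition gen_triple_structure ::
    "('a, 'n::finite) chart set \<Rightarrow> ('a, 'n) gmap \<Rightarrow> ('a, 'n) gmap \<Rightarrow> ('a, 'n) gmap \<Rightarrow> bool"
  where "gen_triple_structure \<A> P Q R \<longleftrightarrow>
    (\<forall>T\<in>{P, Q, R}. gen_almost_product \<A> T \<or> gen_almost_complex \<A> T) \<and>
    (gcommute \<A> P Q \<or> ganticommute \<A> P Q) \<and>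
    (\<forall>s\<in>gsections \<A>. R s = P (Q s))"

definition gen_almost_hypercomplex ::
    "('a, 'n::finite) chart set \<Rightarrow> ('a, 'n) gmap \<Rightarrow> ('a, 'n) gmap \<Rightarrow> ('a, 'n) gmap \<Rightarrow> bool"
  where "gen_almost_hypercomplex \<A> P Q R \<longleftrightarrow>
    gen_triple_structure \<A> P Q R \<and>
    gen_almost_complex \<A> P \<and> gen_almost_complex \<A> Q \<and> gen_almost_complex \<A> R \<and>
    ganticommute \<A> P Q \<and> ganticommute \<A> Q R \<and> ganticommute \<A> P R"

definition gen_almost_bicomplex ::
    "('a, 'n::finite) chart set \<Rightarrow> ('a, 'n) gmap \<Rightarrow> ('a, 'n) gmap \<Rightarrow> ('a, 'n) gmap \<Rightarrow> bool"
  where "gen_almost_bicomplex \<A> P Q R \<longleftrightarrow>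
    gen_triple_structure \<A> P Q R \<and>
    gen_almost_complex \<A> P \<and> gen_almost_complex \<A> Q \<and> gen_almost_product \<A> R \<and>
    gcommute \<A> P Q \<and> gcommute \<A> Q R \<and> gcommute \<A> P R"

definition gen_almost_biparacomplex ::
    "('a, 'n::finite) chart set \<Rightarrow> ('a, 'n) gmap \<Rightarrow> ('a, 'n) gmap \<Rightarrow> ('a, 'n) gmap \<Rightarrow> bool"
  where "gen_almost_biparacomplex \<A> P Q R \<longleftrightarrow>
    gen_triple_structure \<A> P Q R \<and>
    gen_almost_product \<A> P \<and> gen_almost_product \<A> Q \<and> gen_almost_complex \<A> R \<and>
    ganticommute \<A> P Q \<and> ganticommute \<A> Q R \<and> ganticommute \<A> P R"

end

theory Submission
  imports Defs
begin

text \<open>Bump functions extend every tangent vector to a global vector field, so a 1-form is determined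
  by its values on global fields; by Cramer's rule \<open>\<flat>\<^sub>g\<close> is a bijection from vector fields
  onto 1-forms. Hence every section is \<open>X + \<flat>\<^sub>g Z\<close>, and \<open>g(X, JY) = -\<epsilon> g(JX, Y)\<close> gives
  \<open>\<flat>\<^sub>\<phi> = \<flat>\<^sub>g J\<close>, \<open>\<sharp>\<^sub>\<phi> \<flat>\<^sub>g = -J\<close> and \<open>J\<^sup>* \<flat>\<^sub>g = -\<epsilon> \<flat>\<^sub>g J\<close> (the
  latter shows in particular that \<open>J\<^sup>* \<xi>\<close> is a 1-form). In terms of \<open>(X, Z)\<close> all the structures only
  permute \<open>X, Z, JX, JZ\<close> up to sign.\<close>

section \<open>Calculus of \<open>C\<^sup>k\<close> maps\<close>

text \<open>Derivatives at points of an open set depend only on nearby values. \<open>D\<close>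
  compares the \<open>has_derivative\<close> relations themselves, so the values of
  \<open>frechet_derivative\<close> agree even where no derivative exists.\<close>

lemma C_k_on_cong:
  assumes "open S" "\<And>x. x \<in> S \<Longrightarrow> f x = g x"
  shows "C_k_on k S f \<longleftrightarrow> C_k_on k S g"
  using assms(2)
proof (induction k arbitrary: f g)
  case 0
  then show ?case by (auto cong: continuous_on_cong)
next
  case (Suc k)
  have D: "(f has_derivative f') (at x) \<longleftrightarrow> (g has_derivative f') (at x)" if "x \<in> S" for x f'
    using has_derivative_transform_within_open[OF _ assms(1) that, of f f' UNIV g]
      has_derivative_transform_within_open[OF _ assms(1) that, of g f' UNIV f] Suc.prems by auto
  have fr: "frechet_derivative f (at x) = frechet_derivative g (at x)" if "x \<in> S" for x
    using D[OF that] by (simp add: frechet_derivative_def)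
  have "C_k_on k S (\<lambda>x. frechet_derivative f (at x) v) \<longleftrightarrow>
      C_k_on k S (\<lambda>x. frechet_derivative g (at x) v)" for v
    by (rule Suc.IH) (simp add: fr)
  with D show ?case by (auto simp: differentiable_def)
qed

text \<open>Lets the inductions below work with an explicit derivative formula; it agrees with
  \<open>frechet_derivative\<close> on \<open>S\<close>, which suffices by
  \<open>C_k_on_cong\<close>.\<close>

lemma C_k_on_SucI:
  assumes "open S" "\<And>x. x \<in> S \<Longrightarrow> (f has_derivative f' x) (at x)"
    and "\<And>v. C_k_on k S (\<lambda>x. f' x v)"
  shows "C_k_on (Suc k) S f"
proof -
  have "frechet_derivative f (at x) = f' x" if "x \<in> S" for x
    using frechet_derivative_at[OF assms(2)[OF that]] by simp
  then have "C_k_on k S (\<lambda>x. frechet_derivative f (at x) v)" for v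
    using assms(3)[of v] C_k_on_cong[OF assms(1), of "\<lambda>x. frechet_derivative f (at x) v" "\<lambda>x. f' x v"]
    by simp
  with assms(2) show ?thesis by (auto simp: differentiable_def)
qed

lemma C_k_on_Suc_has_derivative:
  assumes "C_k_on (Suc k) S f" "x \<in> S"
  shows "(f has_derivative frechet_derivative f (at x)) (at x)"
  using assms by (auto simp: frechet_derivative_works)

lemma C_k_on_SucD: "C_k_on (Suc k) S f \<Longrightarrow> C_k_on k S f"
proof (induction k arbitrary: f)
  case 0
  then show ?case
    by (auto intro!: continuous_at_imp_continuous_on differentiable_imp_continuous_within)
next
  case (Suc k)
  show ?case
    using Suc.prems Suc.IH unfolding C_k_on.simps(2)[of "Suc k"] C_k_on.simps(2)[of k S f] by blast
qed

text \<open>Used to glue a field that is given by different formulas near and away from the support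
  of a bump function.\<close>

lemma C_k_on_locally:
  assumes "\<And>x. x \<in> S \<Longrightarrow> \<exists>U. open U \<and> x \<in> U \<and> C_k_on k U f"
  shows "C_k_on k S f"
  using assms
proof (induction k arbitrary: f)
  case 0
  show ?case
    unfolding C_k_on.simps
  proof (rule continuous_at_imp_continuous_on, rule ballI)
    fix x assume "x \<in> S"
    then obtain U where "open U" "x \<in> U" "continuous_on U f" using 0 by auto
    then show "isCont f x" by (simp add: continuous_on_eq_continuous_at)
  qed
next
  case (Suc k)
  have "C_k_on k S (\<lambda>x. frechet_derivative f (at x) v)" for v
    by (rule Suc.IH) (use Suc.prems in fastforce)
  moreover have "f differentiable at x" if "x \<in> S" for x
    using Suc.prems[OF that] by auto
  ultimately show ?case by simp
qed

lemma C_k_on_const: "C_k_on k S (\<lambda>x. c)"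
  by (induction k arbitrary: c) (auto simp: frechet_derivative_const)

lemma C_k_on_ident: "open S \<Longrightarrow> C_k_on k S (\<lambda>x. x)"
  by (cases k) (auto intro!: C_k_on_SucI[where f' = "\<lambda>x v. v"] C_k_on_const simp del: C_k_on.simps(2))

lemma C_k_on_add:
  assumes "open S" "C_k_on k S f" "C_k_on k S g"
  shows "C_k_on k S (\<lambda>x. f x + g x)"
  using assms(2,3)
proof (induction k arbitrary: f g)
  case 0
  then show ?case by (auto intro: continuous_on_add)
next
  case (Suc k)
  show ?case
  proof (rule C_k_on_SucI[OF assms(1)])
    show "((\<lambda>x. f x + g x) has_derivative
        (\<lambda>v. frechet_derivative f (at x) v + frechet_derivative g (at x) v)) (at x)" if "x \<in> S" for x
      using Suc.prems that by (intro has_derivative_add C_k_on_Suc_has_derivative)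
    show "C_k_on k S (\<lambda>x. frechet_derivative f (at x) v + frechet_derivative g (at x) v)" for v
      using Suc.prems by (intro Suc.IH) auto
  qed
qed

lemma C_k_on_sum:
  assumes "open S" "\<And>i. i \<in> I \<Longrightarrow> C_k_on k S (f i)"
  shows "C_k_on k S (\<lambda>x. \<Sum>i\<in>I. f i x)"
  using assms(2)
  by (induction I rule: infinite_finite_induct) (auto intro: C_k_on_const C_k_on_add assms(1))

text \<open>The product rule yields two terms of the same bilinear shape. \<open>C_k_on_SucD\<close>
  lowers the undifferentiated factor to order \<open>k\<close>, so the induction hypothesis covers
  both.\<close>

lemma C_k_on_bilinear:
  assumes "bounded_bilinear prd" "open S" "C_k_on k S f" "C_k_on k S g"
  shows "C_k_on k S (\<lambda>x. prd (f x) (g x))"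
  using assms(3,4)
proof (induction k arbitrary: f g)
  case 0
  then show ?case by (auto intro: bounded_bilinear.continuous_on[OF assms(1)])
next
  case (Suc k)
  show ?case
  proof (rule C_k_on_SucI[OF assms(2)])
    show "((\<lambda>x. prd (f x) (g x)) has_derivative
        (\<lambda>v. prd (f x) (frechet_derivative g (at x) v) + prd (frechet_derivative f (at x) v) (g x))) (at x)"
      if "x \<in> S" for x
      using Suc.prems that
      by (intro bounded_bilinear.FDERIV[OF assms(1)] C_k_on_Suc_has_derivative)
    show "C_k_on k S
        (\<lambda>x. prd (f x) (frechet_derivative g (at x) v) + prd (frechet_derivative f (at x) v) (g x))" for v
      using Suc.prems C_k_on_SucD[OF Suc.prems(1)] C_k_on_SucD[OF Suc.prems(2)]
      by (intro C_k_on_add Suc.IH assms(2)) auto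
  qed
qed

lemmas C_k_on_scaleR = C_k_on_bilinear[OF bounded_bilinear_scaleR]
  and C_k_on_mult = C_k_on_bilinear[OF bounded_bilinear_mult]
  and C_k_on_inner = C_k_on_bilinear[OF bounded_bilinear_inner]

lemma C_k_on_prod:
  fixes f :: "'i \<Rightarrow> 'a::real_normed_vector \<Rightarrow> real"
  assumes "open S" "\<And>i. i \<in> I \<Longrightarrow> C_k_on k S (f i)"
  shows "C_k_on k S (\<lambda>x. \<Prod>i\<in>I. f i x)"
  using assms(2)
  by (induction I rule: infinite_finite_induct) (auto intro: C_k_on_const C_k_on_mult assms(1))

text \<open>The derivative contains the reciprocal of \<open>f\<close> again, and the induction
  hypothesis for the same \<open>f\<close> supplies its regularity one order lower.\<close>

lemma C_k_on_inverse:
  fixes f :: "'a::real_normed_vector \<Rightarrow> real"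
  assumes "open S" "C_k_on k S f" "\<And>x. x \<in> S \<Longrightarrow> f x \<noteq> 0"
  shows "C_k_on k S (\<lambda>x. inverse (f x))"
  using assms(2)
proof (induction k)
  case 0
  then show ?case using assms(3) by (auto intro: continuous_on_inverse)
next
  case (Suc k)
  show ?case
  proof (rule C_k_on_SucI[OF assms(1)])
    show "((\<lambda>x. inverse (f x)) has_derivative
        (\<lambda>v. (- 1) * (inverse (f x) * frechet_derivative f (at x) v * inverse (f x)))) (at x)"
      if "x \<in> S" for x
      using Deriv.has_derivative_inverse[OF assms(3)[OF that] C_k_on_Suc_has_derivative[OF Suc.prems that]]
      by simp
    show "C_k_on k S (\<lambda>x. (- 1) * (inverse (f x) * frechet_derivative f (at x) v * inverse (f x)))" for v
      using Suc.prems C_k_on_SucD[OF Suc.prems]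
      by (intro C_k_on_mult C_k_on_const Suc.IH assms(1)) auto
  qed
qed

lemma C_k_on_compose:
  fixes g :: "'a::real_normed_vector \<Rightarrow> 'b::euclidean_space"
  assumes "open S" "C_k_on k S g" "C_k_on k T f" "g ` S \<subseteq> T"
  shows "C_k_on k S (\<lambda>x. f (g x))"
  using assms(2,3)
proof (induction k arbitrary: f)
  case 0
  then show ?case
    using assms(4) by (auto intro: continuous_on_compose2)
next
  case (Suc k)
  have df: "(f has_derivative frechet_derivative f (at y)) (at y)" if "y \<in> T" for y
    using C_k_on_Suc_has_derivative[OF Suc.prems(2) that] .
  show ?case
  proof (rule C_k_on_SucI[OF assms(1)])
    fix x assume x: "x \<in> S"
    then have y: "g x \<in> T" using assms(4) by auto
    have lin: "linear (frechet_derivative f (at (g x)))"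
      using df[OF y] has_derivative_linear by blast
    \<comment> \<open>The chain rule evaluates the derivative of \<open>f\<close> in a direction
      that varies with \<open>x\<close>, whereas \<open>C_k_on\<close> speaks of fixed directions.
      Expanding over the basis leaves fixed directions with variable coefficients.\<close>
    have eq: "frechet_derivative f (at (g x)) w =
        (\<Sum>b\<in>Basis. (w \<bullet> b) *\<^sub>R frechet_derivative f (at (g x)) b)" for w
      by (subst euclidean_representation[of w, symmetric])
        (simp only: linear_sum[OF lin] linear_scale[OF lin])
    show "((\<lambda>x. f (g x)) has_derivative (\<lambda>v. \<Sum>b\<in>Basis.
        (frechet_derivative g (at x) v \<bullet> b) *\<^sub>R frechet_derivative f (at (g x)) b)) (at x)"
      by (rule has_derivative_eq_rhs
          [OF has_derivative_compose[OF C_k_on_Suc_has_derivative[OF Suc.prems(1) x] df[OF y]]])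
        (rule ext, rule eq)
  next
    show "C_k_on k S (\<lambda>x. \<Sum>b\<in>Basis.
        (frechet_derivative g (at x) v \<bullet> b) *\<^sub>R frechet_derivative f (at (g x)) b)" for v
      using Suc.prems C_k_on_SucD[OF Suc.prems(1)]
      by (intro C_k_on_sum C_k_on_scaleR C_k_on_inner C_k_on_const Suc.IH assms(1)) auto
  qed
qed

lemma C_k_on_vec_nth:
  "open S \<Longrightarrow> C_k_on k S f \<Longrightarrow> C_k_on k S (\<lambda>x. f x $ i)"
  for f :: "'a::real_normed_vector \<Rightarrow> real ^ 'n::finite"
  using C_k_on_inner[of S k f "\<lambda>_. axis i 1"] by (simp add: inner_axis C_k_on_const)

lemma vec_eq_sum_axis: "w = (\<Sum>i\<in>UNIV. (w $ i) *\<^sub>R axis i (1::real))"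
  using basis_expansion[of w] by (simp add: scalar_mult_eq_scaleR)

lemma C_k_on_vec_lambda:
  fixes f :: "'a::real_normed_vector \<Rightarrow> real ^ 'n::finite"
  assumes "open S" "\<And>i. C_k_on k S (\<lambda>x. f x $ i)"
  shows "C_k_on k S f"
proof -
  have "C_k_on k S (\<lambda>x. \<Sum>i\<in>UNIV. (f x $ i) *\<^sub>R axis i 1)"
    by (intro C_k_on_sum C_k_on_scaleR assms C_k_on_const)
  then show ?thesis
    by (rule C_k_on_cong[THEN iffD2, OF assms(1) vec_eq_sum_axis])
qed

lemma C_k_on_det:
  fixes M :: "'a::real_normed_vector \<Rightarrow> real ^ 'n ^ 'n::finite"
  assumes "open S" "\<And>i j. C_k_on k S (\<lambda>x. M x $ i $ j)"
  shows "C_k_on k S (\<lambda>x. det (M x))"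
  unfolding det_def by (intro C_k_on_sum C_k_on_mult C_k_on_const C_k_on_prod assms)


section \<open>A smooth function supported in a ball\<close>

text \<open>The functions \<open>x^(-n) e^(-1/x)\<close>, continued by 0. With the parameter
  \<open>n\<close> the family is closed under differentiation up to linear combinations; the bump
  functions use \<open>n = 0\<close>.\<close>

definition flat_exp :: "nat \<Rightarrow> real \<Rightarrow> real"
  where "flat_exp n x = (if x > 0 then inverse x ^ n * exp (- inverse x) else 0)"

text \<open>This is the difference quotient at 0. On the right, substitute \<open>y = 1/x\<close>
  and use that \<open>exp\<close> outgrows every power; on the left it vanishes identically.\<close>

lemma flat_exp_div_tendsto_0: "((\<lambda>x. flat_exp n x / x) \<longlongrightarrow> 0) (at 0)"
proof (rule filterlim_split_at)
  have "((\<lambda>y::real. y ^ Suc n / exp y) \<longlongrightarrow> 0) at_top"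
    by (rule tendsto_power_div_exp_0)
  then have "((\<lambda>x::real. inverse x ^ Suc n / exp (inverse x)) \<longlongrightarrow> 0) (at_right 0)"
    by (rule filterlim_compose[OF _ filterlim_inverse_at_top_right])
  then show "((\<lambda>x. flat_exp n x / x) \<longlongrightarrow> 0) (at_right 0)"
    by (rule Lim_transform_eventually)
      (auto simp: eventually_at_filter flat_exp_def field_simps exp_minus)
  show "((\<lambda>x. flat_exp n x / x) \<longlongrightarrow> 0) (at_left 0)"
    by (rule tendsto_eventually) (auto simp: eventually_at_filter flat_exp_def)
qed

lemma flat_exp_has_derivative:
  "(flat_exp n has_real_derivative (flat_exp (n + 2) x + (- real n) * flat_exp (n + 1) x)) (at x)"
proof (cases x "0::real" rule: linorder_cases)
  case less
  have "((\<lambda>_. 0) has_real_derivative 0) (at x)" by simp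
  then have "(flat_exp n has_real_derivative 0) (at x)"
    by (rule has_field_derivative_transform_within_open[of _ _ _ "{..<0}"])
      (use less in \<open>auto simp: flat_exp_def\<close>)
  then show ?thesis using less by (simp add: flat_exp_def)
next
  case equal
  then show ?thesis
    using flat_exp_div_tendsto_0[of n]
    by (simp add: has_field_derivative_iff flat_exp_def)
next
  case greater
  have "((\<lambda>x. inverse x ^ n * exp (- inverse x)) has_real_derivative
      flat_exp (n + 2) x + (- real n) * flat_exp (n + 1) x) (at x)"
  proof (rule DERIV_cong)
    show "((\<lambda>x. inverse x ^ n * exp (- inverse x)) has_real_derivative
        real n * inverse x ^ (n - 1) * (- (inverse x * inverse x)) * exp (- inverse x) +
        exp (- inverse x) * (inverse x * inverse x) * inverse x ^ n) (at x)"
      using greater by (auto intro!: derivative_eq_intros)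
    \<comment> \<open>The case split on \<open>n\<close> handles the truncated exponent
      \<open>n - 1\<close>: for \<open>n = 0\<close> the factor \<open>real n\<close> removes the
      term.\<close>
    show "real n * inverse x ^ (n - 1) * (- (inverse x * inverse x)) * exp (- inverse x) +
        exp (- inverse x) * (inverse x * inverse x) * inverse x ^ n =
        flat_exp (n + 2) x + (- real n) * flat_exp (n + 1) x"
      using greater by (cases n) (simp_all add: flat_exp_def algebra_simps)
  qed
  then show ?thesis
    by (rule has_field_derivative_transform_within_open[of _ _ _ "{0<..}"])
      (use greater in \<open>auto simp: flat_exp_def\<close>)
qed

lemma C_k_on_flat_exp: "C_k_on k UNIV (flat_exp n)"
proof (induction k arbitrary: n)
  case 0
  show ?case
    using DERIV_isCont[OF flat_exp_has_derivative] by (auto intro!: continuous_at_imp_continuous_on)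
next
  case (Suc k)
  show ?case
  proof (rule C_k_on_SucI)
    show "(flat_exp n has_derivative
        (*) (flat_exp (n + 2) x + (- real n) * flat_exp (n + 1) x)) (at x)" for x
      using flat_exp_has_derivative by (simp add: has_field_derivative_def)
    show "C_k_on k UNIV (\<lambda>x. (flat_exp (n + 2) x + (- real n) * flat_exp (n + 1) x) * v)" for v
      by (intro C_k_on_mult C_k_on_add C_k_on_const Suc.IH open_UNIV)
  qed simp
qed

lemma bump_function:
  fixes a :: "'b::euclidean_space"
  assumes "r > 0"
  obtains \<rho> :: "'b \<Rightarrow> real" where "smooth_on UNIV \<rho>" "\<rho> a = 1" "\<And>y. y \<notin> cball a r \<Longrightarrow> \<rho> y = 0"
proof
  \<comment> \<open>\<open>?q\<close> is positive exactly on the open ball of radius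
    \<open>r\<close>, and its value \<open>r^2\<close> at \<open>a\<close> explains the normalising
    factor of \<open>?\<rho>\<close>. Differences are written as sums to fit the closure
    rules.\<close>
  let ?q = "\<lambda>y. r\<^sup>2 + (- 1) * ((y + - a) \<bullet> (y + - a))"
  let ?\<rho> = "\<lambda>y. inverse (flat_exp 0 (r\<^sup>2)) * flat_exp 0 (?q y)"
  have "C_k_on k UNIV ?q" for k
    by (intro C_k_on_add C_k_on_mult C_k_on_inner C_k_on_const C_k_on_ident open_UNIV)
  then have "C_k_on k UNIV (\<lambda>y. flat_exp 0 (?q y))" for k
    by (rule C_k_on_compose[OF open_UNIV _ C_k_on_flat_exp]) auto
  then show "smooth_on UNIV ?\<rho>"
    unfolding smooth_on_def by (intro allI C_k_on_mult C_k_on_const open_UNIV)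
  show "?\<rho> a = 1" using assms by (simp add: flat_exp_def)
  show "?\<rho> y = 0" if "y \<notin> cball a r" for y
  proof -
    have "r < norm (y - a)" using that by (simp add: dist_norm norm_minus_commute)
    then have "r\<^sup>2 < (norm (y - a))\<^sup>2" using assms by (intro power_strict_mono) auto
    then show ?thesis by (simp add: flat_exp_def dot_square_norm)
  qed
qed


section \<open>Tangent vectors and global vector fields\<close>

locale smooth_atlas =
  fixes \<A> :: "('a::{t2_space, second_countable_topology}, 'n::finite) chart set"
  assumes manifold: "smooth_manifold \<A>"
begin

section \<open>Charts, transition maps and their Jacobians\<close>

lemma
  assumes "c \<in> \<A>"
  shows open_domain: "open (fst c)"
    and open_chart_range: "open (chart_range c)"
    and continuous_on_chart_inv: "continuous_on (chart_range c) (chart_inv c)"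
    and chart_inv_chart: "\<And>q. q \<in> fst c \<Longrightarrow> chart_inv c (snd c q) = q"
    and chart_chart_inv: "\<And>x. x \<in> chart_range c \<Longrightarrow> snd c (chart_inv c x) = x"
    and chart_inv_in: "\<And>x. x \<in> chart_range c \<Longrightarrow> chart_inv c x \<in> fst c"
proof -
  have "is_chart c" using manifold assms by (simp add: smooth_manifold_def)
  then have o: "open (fst c)" "open (chart_range c)"
    and h: "homeomorphism (fst c) (chart_range c) (snd c) (chart_inv c)"
    by (auto simp: is_chart_def)
  from o show "open (fst c)" "open (chart_range c)" by auto
  from h show "continuous_on (chart_range c) (chart_inv c)"
    "\<And>q. q \<in> fst c \<Longrightarrow> chart_inv c (snd c q) = q"
    "\<And>x. x \<in> chart_range c \<Longrightarrow> snd c (chart_inv c x) = x"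
    "\<And>x. x \<in> chart_range c \<Longrightarrow> chart_inv c x \<in> fst c"
    by (auto simp: homeomorphism_def)
qed

lemma chart_in_range: "q \<in> fst c \<Longrightarrow> snd c q \<in> chart_range c"
  by (simp add: chart_range_def)

lemma chart_around: obtains c where "c \<in> \<A>" "p \<in> fst c"
  using manifold unfolding smooth_manifold_def by blast

text \<open>In coordinates the set is the preimage of \<open>U\<close> under the continuous inverse
  chart. This makes chart overlaps open in coordinates, so that derivatives there are local.\<close>

lemma open_chart_image:
  assumes "c \<in> \<A>" "open U"
  shows "open (snd c ` (fst c \<inter> U))"
proof -
  have "snd c ` (fst c \<inter> U) = chart_range c \<inter> chart_inv c -` U"
    using chart_inv_chart[OF assms(1)] chart_chart_inv[OF assms(1)] chart_inv_in[OF assms(1)]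
    by (force simp: chart_range_def)
  then show ?thesis
    using continuous_open_preimage[OF continuous_on_chart_inv open_chart_range] assms by simp
qed

lemma smooth_transition:
  "c \<in> \<A> \<Longrightarrow> d \<in> \<A> \<Longrightarrow> smooth_on (snd c ` (fst c \<inter> fst d)) (transition c d)"
  using manifold by (simp add: smooth_manifold_def)

lemma transition_chart: "c \<in> \<A> \<Longrightarrow> q \<in> fst c \<Longrightarrow> transition c d (snd c q) = snd d q"
  by (simp add: transition_def chart_inv_chart)

abbreviation jac :: "('a, 'n) chart \<Rightarrow> ('a, 'n) chart \<Rightarrow> 'a \<Rightarrow> real ^ 'n \<Rightarrow> real ^ 'n"
  where "jac c d q \<equiv> frechet_derivative (transition c d) (at (snd c q))"

lemma transition_has_derivative:
  assumes "c \<in> \<A>" "d \<in> \<A>" "q \<in> fst c" "q \<in> fst d"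
  shows "(transition c d has_derivative jac c d q) (at (snd c q))"
proof -
  have "C_k_on (Suc 0) (snd c ` (fst c \<inter> fst d)) (transition c d)"
    using smooth_transition[OF assms(1,2)] unfolding smooth_on_def by blast
  then show ?thesis by (rule C_k_on_Suc_has_derivative) (use assms in auto)
qed

lemma linear_jac:
  "c \<in> \<A> \<Longrightarrow> d \<in> \<A> \<Longrightarrow> q \<in> fst c \<Longrightarrow> q \<in> fst d \<Longrightarrow> linear (jac c d q)"
  using transition_has_derivative has_derivative_linear by blast

lemma jac_refl:
  assumes "c \<in> \<A>" "q \<in> fst c"
  shows "jac c c q w = w"
proof -
  have "((\<lambda>x. x) has_derivative (\<lambda>x. x)) (at (snd c q))" by simp
  then have "(transition c c has_derivative (\<lambda>x. x)) (at (snd c q))"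
    by (rule has_derivative_transform_within_open[OF _ open_chart_range[OF assms(1)]])
      (use assms in \<open>auto simp: chart_in_range transition_def chart_chart_inv\<close>)
  then show ?thesis
    using frechet_derivative_at by metis
qed

text \<open>Chain rule: the transition from \<open>c\<close> to \<open>e\<close> factors through
  \<open>d\<close> on the coordinate image of the overlap of \<open>c\<close> and \<open>d\<close>,
  which is open.\<close>

lemma jac_jac:
  assumes c: "c \<in> \<A>" "q \<in> fst c" and d: "d \<in> \<A>" "q \<in> fst d" and e: "e \<in> \<A>" "q \<in> fst e"
  shows "jac d e q (jac c d q w) = jac c e q w"
proof -
  have "(transition d e has_derivative jac d e q) (at (transition c d (snd c q)))"
    using transition_has_derivative[OF d(1) e(1)] assms by (simp add: transition_chart)
  then have "((\<lambda>x. transition d e (transition c d x)) has_derivative (\<lambda>w. jac d e q (jac c d q w)))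
      (at (snd c q))"
    using has_derivative_compose[OF transition_has_derivative[OF c(1) d(1) c(2) d(2)]] by blast
  then have "(transition c e has_derivative (\<lambda>w. jac d e q (jac c d q w))) (at (snd c q))"
    by (rule has_derivative_transform_within_open[OF _ open_chart_image[OF c(1) open_domain[OF d(1)]]])
      (use assms in \<open>auto simp: transition_chart\<close>)
  then show ?thesis
    using frechet_derivative_at by metis
qed

section \<open>Tangent vectors in terms of their components in one chart\<close>

definition tvec_of :: "('a, 'n) chart \<Rightarrow> real ^ 'n \<Rightarrow> 'a \<Rightarrow> ('a, 'n) tvec"
  where "tvec_of c w q = (\<lambda>d. if d \<in> \<A> \<and> q \<in> fst d then jac c d q w else 0)"

lemma coord_vec_eq: "coord_vec \<A> c i q = tvec_of c (axis i 1) q"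
  by (simp add: coord_vec_def tvec_of_def)

lemma tvec_of_in_tangent_space:
  "c \<in> \<A> \<Longrightarrow> q \<in> fst c \<Longrightarrow> tvec_of c w q \<in> tangent_space \<A> q"
  by (auto simp: tangent_space_def tvec_of_def jac_jac)

lemma coord_vec_in_tangent_space:
  "c \<in> \<A> \<Longrightarrow> q \<in> fst c \<Longrightarrow> coord_vec \<A> c i q \<in> tangent_space \<A> q"
  by (simp add: coord_vec_eq tvec_of_in_tangent_space)

lemma tvec_of_same: "c \<in> \<A> \<Longrightarrow> q \<in> fst c \<Longrightarrow> tvec_of c w q c = w"
  by (simp add: tvec_of_def jac_refl)

text \<open>The component in \<open>c\<close> determines all others. Together with
  \<open>tvec_of_same\<close> this identifies the tangent space with \<open>real ^ 'n\<close>, from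
  which its closure under sums and multiples is transported.\<close>

lemma tangent_vector_eq:
  assumes "c \<in> \<A>" "q \<in> fst c" "v \<in> tangent_space \<A> q"
  shows "tvec_of c (v c) q = v"
proof (rule ext)
  fix d
  have "v d = jac c d q (v c)" if "d \<in> \<A>" "q \<in> fst d"
    using assms that unfolding tangent_space_def by blast
  moreover have "v d = 0" if "\<not> (d \<in> \<A> \<and> q \<in> fst d)"
    using assms that unfolding tangent_space_def by blast
  ultimately show "tvec_of c (v c) q d = v d" by (metis tvec_of_def)
qed

lemma tvec_of_add:
  "c \<in> \<A> \<Longrightarrow> q \<in> fst c \<Longrightarrow> tvec_of c (v + w) q = tvec_of c v q + tvec_of c w q"
  by (auto simp: tvec_of_def fun_eq_iff linear_add[OF linear_jac])

lemma tvec_of_scaleR: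
  "c \<in> \<A> \<Longrightarrow> q \<in> fst c \<Longrightarrow> tvec_of c (a *\<^sub>R w) q = a *\<^sub>R tvec_of c w q"
  by (auto simp: tvec_of_def fun_eq_iff scaleR_fun_def linear_scale[OF linear_jac])

lemma tangent_space_add:
  "u \<in> tangent_space \<A> p \<Longrightarrow> v \<in> tangent_space \<A> p \<Longrightarrow> u + v \<in> tangent_space \<A> p"
  by (metis chart_around tangent_vector_eq tvec_of_add tvec_of_in_tangent_space)

lemma tangent_space_scaleR: "v \<in> tangent_space \<A> p \<Longrightarrow> a *\<^sub>R v \<in> tangent_space \<A> p"
  by (metis chart_around tangent_vector_eq tvec_of_scaleR tvec_of_in_tangent_space)

lemma tangent_space_0: "0 \<in> tangent_space \<A> p"
proof -
  obtain c where "c \<in> \<A>" "p \<in> fst c" by (rule chart_around)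
  then show ?thesis
    using tangent_space_scaleR[OF tvec_of_in_tangent_space, of c p 0] by simp
qed

text \<open>Linearity is demanded on the tangent space alone, because forms are continued by 0 and
  need not be linear on the whole type. Composed with \<open>tvec_of c\<close>, \<open>L\<close>
  becomes linear on \<open>real ^ 'n\<close> and is expanded over the standard basis.\<close>

lemma linear_form_eq_sum:
  assumes c: "c \<in> \<A>" "p \<in> fst c" and v: "v \<in> tangent_space \<A> p"
    and add: "\<And>u v. u \<in> tangent_space \<A> p \<Longrightarrow> v \<in> tangent_space \<A> p \<Longrightarrow> L (u + v) = L u + L v"
    and scale: "\<And>a v. v \<in> tangent_space \<A> p \<Longrightarrow> L (a *\<^sub>R v) = a * L v"
  shows "L v = (\<Sum>i\<in>UNIV. (v c $ i) * (L (coord_vec \<A> c i p) :: real))"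
proof -
  have lin: "linear (\<lambda>w. L (tvec_of c w p))"
    using c by (intro linearI) (simp_all add: tvec_of_add tvec_of_scaleR add scale tvec_of_in_tangent_space)
  have "L v = L (tvec_of c (v c) p)"
    using tangent_vector_eq[OF c v] by simp
  also have "\<dots> = L (tvec_of c (\<Sum>i\<in>UNIV. (v c $ i) *\<^sub>R axis i 1) p)"
    by (rule arg_cong[where f = "\<lambda>w. L (tvec_of c w p)"]) (rule vec_eq_sum_axis)
  also have "\<dots> = (\<Sum>i\<in>UNIV. (v c $ i) * L (coord_vec \<A> c i p))"
    by (simp add: linear_sum[OF lin] linear_scale[OF lin] coord_vec_eq)
  finally show ?thesis .
qed

section \<open>Global vector fields and the extension of tangent vectors\<close>

lemma vector_fields_in_tangent_space: "X \<in> vector_fields \<A> \<Longrightarrow> X p \<in> tangent_space \<A> p"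
  by (simp add: vector_fields_def)

lemma vector_fields_C_k:
  "X \<in> vector_fields \<A> \<Longrightarrow> c \<in> \<A> \<Longrightarrow> C_k_on k (chart_range c) (\<lambda>x. X (chart_inv c x) c)"
  by (simp add: vector_fields_def smooth_on_def)

lemma vector_fields_add:
  "X \<in> vector_fields \<A> \<Longrightarrow> Y \<in> vector_fields \<A> \<Longrightarrow> X + Y \<in> vector_fields \<A>"
  by (auto simp: vector_fields_def smooth_on_def intro!: tangent_space_add C_k_on_add open_chart_range)

lemma vector_fields_fscale:
  "f \<in> smooth_functions \<A> \<Longrightarrow> X \<in> vector_fields \<A> \<Longrightarrow> fscale f X \<in> vector_fields \<A>"
  by (auto simp: vector_fields_def smooth_functions_def smooth_on_def fscale_def scaleR_fun_def o_def
      intro!: tangent_space_scaleR[unfolded scaleR_fun_def] C_k_on_scaleR open_chart_range)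

lemma smooth_functions_const: "(\<lambda>_. a) \<in> smooth_functions \<A>"
  by (simp add: smooth_functions_def smooth_on_def o_def C_k_on_const)

lemma vector_fields_scaleR: "X \<in> vector_fields \<A> \<Longrightarrow> a *\<^sub>R X \<in> vector_fields \<A>"
  using vector_fields_fscale[OF smooth_functions_const, of X a] by (simp add: fscale_def scaleR_fun_def)

lemma vector_fields_minus: "X \<in> vector_fields \<A> \<Longrightarrow> - X \<in> vector_fields \<A>"
  using vector_fields_scaleR[of X "- 1"] by simp

text \<open>The extension has constant components in a chart around \<open>p\<close>, cut off by a bump function.
  Its support is compact, hence closed because the manifold is Hausdorff, so that the field
  stays smooth when it is continued by \<open>0\<close>.\<close>

lemma tangent_vector_extends:
  assumes v: "v \<in> tangent_space \<A> p"
  obtains X where "X \<in> vector_fields \<A>" "X p = v"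
proof -
  obtain c where c: "c \<in> \<A>" and p: "p \<in> fst c" by (rule chart_around)
  obtain r where r: "r > 0" "cball (snd c p) r \<subseteq> chart_range c"
    using open_chart_range[OF c] chart_in_range[OF p] open_contains_cball by blast
  obtain \<rho> :: "real ^ 'n \<Rightarrow> real" where \<rho>: "smooth_on UNIV \<rho>" "\<rho> (snd c p) = 1"
    "\<And>y. y \<notin> cball (snd c p) r \<Longrightarrow> \<rho> y = 0"
    using bump_function[OF r(1)] by metis
  define K where "K = chart_inv c ` cball (snd c p) r"
  have "compact K"
    unfolding K_def using continuous_on_subset[OF continuous_on_chart_inv[OF c] r(2)]
    by (intro compact_continuous_image compact_cball)
  then have K: "open (- K)" by (simp add: compact_imp_closed open_Compl)
  define X where "X q = (if q \<in> fst c then \<rho> (snd c q) *\<^sub>R tvec_of c (v c) q else 0)" for q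
  have out: "X q = 0" if "q \<notin> K" for q
    using that \<rho>(3)[of "snd c q"] chart_inv_chart[OF c, of q] by (force simp: X_def K_def)
  have "X q \<in> tangent_space \<A> q" for q
    using c by (simp add: X_def tangent_space_scaleR tvec_of_in_tangent_space tangent_space_0)
  moreover have "smooth_on (chart_range d) (\<lambda>x. X (chart_inv d x) d)" if d: "d \<in> \<A>" for d
    unfolding smooth_on_def
  proof (intro allI C_k_on_locally)
    fix k x assume x: "x \<in> chart_range d"
    show "\<exists>U. open U \<and> x \<in> U \<and> C_k_on k U (\<lambda>x. X (chart_inv d x) d)"
    proof (cases "chart_inv d x \<in> fst c")
      case True
      \<comment> \<open>On the overlap the \<open>d\<close>-component of \<open>X\<close> is the
        bump factor times the Jacobian of the transition from \<open>c\<close> to \<open>d\<close>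
        applied to \<open>v c\<close>, both pulled back to \<open>d\<close>-coordinates.\<close>
      let ?U = "snd d ` (fst d \<inter> fst c)" and ?V = "snd c ` (fst c \<inter> fst d)"
      have U: "open ?U" by (rule open_chart_image[OF d open_domain[OF c]])
      have tr: "C_k_on k ?U (transition d c)"
        using smooth_transition[OF d c] by (simp add: smooth_on_def)
      have tr_im: "transition d c ` ?U \<subseteq> ?V" using d by (auto simp: transition_chart)
      \<comment> \<open>One order more is taken because the Jacobian costs a derivative.\<close>
      have "C_k_on (Suc k) ?V (transition c d)"
        using smooth_transition[OF c d] unfolding smooth_on_def by blast
      then have "C_k_on k ?V (\<lambda>y. frechet_derivative (transition c d) (at y) (v c))" by simp
      then have "C_k_on k ?U (\<lambda>x. frechet_derivative (transition c d) (at (transition d c x)) (v c))"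
        by (rule C_k_on_compose[OF U tr _ tr_im])
      moreover have "C_k_on k ?U (\<lambda>x. \<rho> (transition d c x))"
        by (rule C_k_on_compose[OF U tr, of UNIV]) (use \<rho>(1) in \<open>auto simp: smooth_on_def\<close>)
      ultimately have "C_k_on k ?U (\<lambda>x. \<rho> (transition d c x) *\<^sub>R
          frechet_derivative (transition c d) (at (transition d c x)) (v c))"
        by (intro C_k_on_scaleR U)
      then have "C_k_on k ?U (\<lambda>x. X (chart_inv d x) d)"
        by (rule C_k_on_cong[OF U, THEN iffD1, rotated])
          (use d in \<open>auto simp: X_def tvec_of_def scaleR_fun_def transition_chart chart_inv_chart\<close>)
      moreover have "x \<in> ?U"
        using True chart_inv_in[OF d x] chart_chart_inv[OF d x] by force
      ultimately show ?thesis using U by blast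
    next
      case False
      \<comment> \<open>A point outside the domain of \<open>c\<close> is outside \<open>K\<close>.
        Its neighbourhood \<open>- K\<close> may meet that domain, but \<open>out\<close> makes
        \<open>X\<close> vanish there as well.\<close>
      let ?U = "snd d ` (fst d \<inter> - K)"
      have U: "open ?U" by (rule open_chart_image[OF d K])
      have "C_k_on k ?U (\<lambda>x. X (chart_inv d x) d)"
        by (rule C_k_on_cong[OF U, THEN iffD1, OF _ C_k_on_const[of _ _ 0]])
          (use d in \<open>auto simp: out chart_inv_chart\<close>)
      moreover have "chart_inv d x \<notin> K"
        using False r(2) chart_inv_in[OF c] by (auto simp: K_def)
      then have "x \<in> ?U"
        using chart_inv_in[OF d x] chart_chart_inv[OF d x] by force
      ultimately show ?thesis using U by blast
    qed
  qed
  ultimately have "X \<in> vector_fields \<A>" by (simp add: vector_fields_def)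
  moreover have "X p = v"
    using c p v by (simp add: X_def \<rho>(2) tangent_vector_eq)
  ultimately show thesis by (rule that)
qed

text \<open>Every tangent vector is a value of a global field, which fixes both forms on tangent
  spaces; elsewhere both are 0 by convention.\<close>

lemma one_form_eqI:
  assumes "\<xi> \<in> one_forms \<A>" "\<eta> \<in> one_forms \<A>"
    and "\<And>X. X \<in> vector_fields \<A> \<Longrightarrow> form_app \<xi> X = form_app \<eta> X"
  shows "\<xi> = \<eta>"
proof (intro ext)
  fix p v
  show "\<xi> p v = \<eta> p v"
  proof (cases "v \<in> tangent_space \<A> p")
    case True
    then obtain X where "X \<in> vector_fields \<A>" "X p = v" by (rule tangent_vector_extends)
    then show ?thesis using fun_cong[OF assms(3), of X p] by (simp add: form_app_def)
  next
    case False
    then show ?thesis using assms(1,2) by (simp add: one_forms_def cotangent_space_def)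
  qed
qed

end


section \<open>The musical isomorphism\<close>

locale metric_atlas = smooth_atlas \<A>
  for \<A> :: "('a::{t2_space, second_countable_topology}, 'n::finite) chart set" +
  fixes g :: "('a, 'n) tensor02"
  assumes metric: "pseudo_Riemannian_metric \<A> g"
begin

lemma
  assumes "u \<in> tangent_space \<A> p" "v \<in> tangent_space \<A> p"
  shows metric_sym: "g p u v = g p v u"
    and metric_scale_left: "g p (a *\<^sub>R u) v = a * g p u v"
    and metric_scale_right: "g p u (a *\<^sub>R v) = a * g p u v"
    and metric_add_left: "w \<in> tangent_space \<A> p \<Longrightarrow> g p (u + v) w = g p u w + g p v w"
    and metric_add_right: "w \<in> tangent_space \<A> p \<Longrightarrow> g p w (u + v) = g p w u + g p w v"
proof -
  have sym: "g p u v = g p v u" if "u \<in> tangent_space \<A> p" "v \<in> tangent_space \<A> p" for u v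
    using metric that unfolding pseudo_Riemannian_metric_def by blast
  have "\<forall>p a. \<forall>u\<in>tangent_space \<A> p. \<forall>v\<in>tangent_space \<A> p. g p (a *\<^sub>R u) v = a * g p u v"
    using metric unfolding pseudo_Riemannian_metric_def by (elim conjE)
  then have scale: "g p (a *\<^sub>R u) v = a * g p u v"
    if "u \<in> tangent_space \<A> p" "v \<in> tangent_space \<A> p" for u v
    using that by blast
  show "g p u v = g p v u" "g p (a *\<^sub>R u) v = a * g p u v"
    by (rule sym[OF assms], rule scale[OF assms])
  have "\<forall>p. \<forall>u\<in>tangent_space \<A> p. \<forall>v\<in>tangent_space \<A> p. \<forall>w\<in>tangent_space \<A> p.
      g p (u + v) w = g p u w + g p v w"
    using metric unfolding pseudo_Riemannian_metric_def by (elim conjE)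
  then show add: "g p (u + v) w = g p u w + g p v w" if "w \<in> tangent_space \<A> p"
    using that assms by blast
  show "g p u (a *\<^sub>R v) = a * g p u v"
    by (metis assms sym scale tangent_space_scaleR)
  show "g p w (u + v) = g p w u + g p w v" if "w \<in> tangent_space \<A> p"
    by (metis assms that sym add tangent_space_add)
qed

lemma metric_nondegenerate:
  assumes "u \<in> tangent_space \<A> p" "\<And>v. v \<in> tangent_space \<A> p \<Longrightarrow> g p u v = 0"
  shows "u = 0"
  using metric assms unfolding pseudo_Riemannian_metric_def by blast

lemma metric_C_k:
  "c \<in> \<A> \<Longrightarrow> C_k_on k (chart_range c)
     (\<lambda>x. g (chart_inv c x) (coord_vec \<A> c i (chart_inv c x)) (coord_vec \<A> c j (chart_inv c x)))"
  using metric unfolding pseudo_Riemannian_metric_def smooth_on_def by blast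

text \<open>A closed form of \<flat> for \<open>g\<close>, cut off to 0 as
  \<open>cotangent_space\<close> demands. \<open>flat\<close> itself is a definite description and
  is identified with this map in \<open>flat_metric\<close>.\<close>

definition musical :: "('a, 'n) vfield \<Rightarrow> ('a, 'n) oneform"
  where "musical X p v = (if v \<in> tangent_space \<A> p then g p (X p) v else 0)"

lemma metric_eq_sum:
  assumes "c \<in> \<A>" "p \<in> fst c" "u \<in> tangent_space \<A> p" "v \<in> tangent_space \<A> p"
  shows "g p u v = (\<Sum>i\<in>UNIV. (u c $ i) * g p (coord_vec \<A> c i p) v)"
  using assms by (intro linear_form_eq_sum[of _ _ _ "\<lambda>u. g p u v"])
    (simp_all add: metric_add_left metric_scale_left)

lemma musical_in_one_forms:
  assumes X: "X \<in> vector_fields \<A>"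
  shows "musical X \<in> one_forms \<A>"
proof -
  have "C_k_on k (chart_range c)
      (\<lambda>x. musical X (chart_inv c x) (coord_vec \<A> c i (chart_inv c x)))" if c: "c \<in> \<A>" for k c i
  proof -
    have "C_k_on k (chart_range c) (\<lambda>x. \<Sum>j\<in>UNIV. (X (chart_inv c x) c $ j) *
        g (chart_inv c x) (coord_vec \<A> c j (chart_inv c x)) (coord_vec \<A> c i (chart_inv c x)))"
      using open_chart_range[OF c] vector_fields_C_k[OF X c] metric_C_k[OF c]
      by (intro C_k_on_sum C_k_on_mult C_k_on_vec_nth)
    then show ?thesis
      by (rule C_k_on_cong[OF open_chart_range[OF c], THEN iffD1, rotated])
        (use c X in \<open>simp add: musical_def coord_vec_in_tangent_space chart_inv_in
          metric_eq_sum[of c _ "X _"] vector_fields_in_tangent_space\<close>)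
  qed
  moreover have "musical X p \<in> cotangent_space \<A> p" for p
    using vector_fields_in_tangent_space[OF X]
    by (auto simp: cotangent_space_def musical_def metric_add_right metric_scale_right
        tangent_space_add tangent_space_scaleR)
  ultimately show ?thesis by (simp add: one_forms_def smooth_on_def)
qed

lemma form_app_musical:
  "X \<in> vector_fields \<A> \<Longrightarrow> Y \<in> vector_fields \<A> \<Longrightarrow> form_app (musical X) Y = on_fields g X Y"
  by (simp add: form_app_def musical_def on_fields_def vector_fields_in_tangent_space)

lemma musical_eqI:
  assumes "\<xi> \<in> one_forms \<A>" "Z \<in> vector_fields \<A>"
    and "\<And>Y. Y \<in> vector_fields \<A> \<Longrightarrow> form_app \<xi> Y = on_fields g Z Y"
  shows "\<xi> = musical Z"
  using assms by (intro one_form_eqI) (simp_all add: musical_in_one_forms form_app_musical)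

lemma musical_add:
  "X \<in> vector_fields \<A> \<Longrightarrow> Y \<in> vector_fields \<A> \<Longrightarrow> musical (X + Y) = musical X + musical Y"
  by (auto simp: musical_def fun_eq_iff metric_add_left vector_fields_in_tangent_space)

lemma musical_fscale: "X \<in> vector_fields \<A> \<Longrightarrow> musical (fscale f X) = fscale f (musical X)"
  by (auto simp: musical_def fun_eq_iff fscale_def scaleR_fun_def[of _ "musical X _"]
      metric_scale_left vector_fields_in_tangent_space)

lemma musical_scaleR: "X \<in> vector_fields \<A> \<Longrightarrow> musical (a *\<^sub>R X) = a *\<^sub>R musical X"
  using musical_fscale[of X "\<lambda>_. a"] by (simp add: fscale_def scaleR_fun_def)

lemma musical_minus: "X \<in> vector_fields \<A> \<Longrightarrow> musical (- X) = - musical X"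
  using musical_scaleR[of X "- 1"] by simp

text \<open>The difference of two fields with the same image is orthogonal to every tangent vector
  at each point.\<close>

lemma inj_on_musical: "inj_on musical (vector_fields \<A>)"
proof (rule inj_onI, rule ext)
  fix X Y p assume X: "X \<in> vector_fields \<A>" and Y: "Y \<in> vector_fields \<A>"
    and eq: "musical X = musical Y"
  have "(X + - Y) p = 0"
  proof (rule metric_nondegenerate)
    show "(X + - Y) p \<in> tangent_space \<A> p"
      using X Y by (intro vector_fields_in_tangent_space vector_fields_add vector_fields_minus)
    have "musical (X + - Y) = 0"
      using musical_add[OF X vector_fields_minus[OF Y]] musical_minus[OF Y] eq by simp
    then show "g p ((X + - Y) p) v = 0" if "v \<in> tangent_space \<A> p" for v
      using that by (metis musical_def zero_fun_apply)
  qed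
  then show "X p = Y p" by simp
qed

section \<open>Inverting the metric through its Gram matrix\<close>

definition gram :: "('a, 'n) chart \<Rightarrow> 'a \<Rightarrow> real ^ 'n ^ 'n"
  where "gram c p = (\<chi> i j. g p (coord_vec \<A> c i p) (coord_vec \<A> c j p))"

lemma gram_mult:
  assumes "c \<in> \<A>" "p \<in> fst c" "u \<in> tangent_space \<A> p"
  shows "(gram c p *v u c) $ i = g p u (coord_vec \<A> c i p)"
  using assms
  by (simp add: gram_def matrix_vector_mult_def metric_eq_sum[of c p u] coord_vec_in_tangent_space
      metric_sym[of "coord_vec \<A> c i p"] mult.commute)

text \<open>A kernel vector holds the components of a tangent vector orthogonal to all coordinate
  vectors, hence to the whole tangent space, and nondegeneracy makes it 0.\<close>

lemma det_gram_nonzero: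
  assumes c: "c \<in> \<A>" "p \<in> fst c"
  shows "det (gram c p) \<noteq> 0"
proof -
  have "x = 0" if "gram c p *v x = 0" for x
  proof -
    let ?u = "tvec_of c x p"
    have u: "?u \<in> tangent_space \<A> p" "?u c = x" using c by (auto simp: tvec_of_in_tangent_space tvec_of_same)
    have "g p ?u (coord_vec \<A> c i p) = 0" for i
      using gram_mult[OF c u(1), of i] that u(2) by simp
    then have "g p ?u v = 0" if "v \<in> tangent_space \<A> p" for v
      using metric_eq_sum[OF c that u(1)] metric_sym[OF u(1)] that c
      by (simp add: coord_vec_in_tangent_space)
    then have "?u = 0" using u(1) by (intro metric_nondegenerate)
    then show ?thesis using u(2) by simp
  qed
  then show ?thesis
    by (metis matrix_left_invertible_ker invertible_left_inverse invertible_det_nz)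
qed

text \<open>Pointwise the metric is inverted by Cramer's rule, which also shows that the solution
  depends smoothly on the point.\<close>

lemma one_form_eq_musical:
  assumes \<xi>: "\<xi> \<in> one_forms \<A>"
  obtains Z where "Z \<in> vector_fields \<A>" "\<xi> = musical Z"
proof -
  define b where "b c p = (\<chi> i. \<xi> p (coord_vec \<A> c i p))" for c p
  have \<xi>_add: "\<xi> p (u + v) = \<xi> p u + \<xi> p v"
    and \<xi>_scale: "\<xi> p (a *\<^sub>R u) = a * \<xi> p u"
    if "u \<in> tangent_space \<A> p" "v \<in> tangent_space \<A> p" for p u v a
    using \<xi> that by (auto simp: one_forms_def cotangent_space_def)
  have \<xi>_out: "\<xi> p v = 0" if "v \<notin> tangent_space \<A> p" for p v
    using \<xi> that by (auto simp: one_forms_def cotangent_space_def)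
  have "\<exists>u\<in>tangent_space \<A> p. \<forall>v\<in>tangent_space \<A> p. g p u v = \<xi> p v" for p
  proof -
    obtain c where c: "c \<in> \<A>" "p \<in> fst c" by (rule chart_around)
    obtain x where x: "gram c p *v x = b c p"
      using cramer[OF det_gram_nonzero[OF c]] by blast
    let ?u = "tvec_of c x p"
    have u: "?u \<in> tangent_space \<A> p" "?u c = x" using c by (auto simp: tvec_of_in_tangent_space tvec_of_same)
    have *: "g p ?u (coord_vec \<A> c i p) = \<xi> p (coord_vec \<A> c i p)" for i
      using gram_mult[OF c u(1), of i] x u(2) by (simp add: b_def)
    have "g p ?u v = \<xi> p v" if v: "v \<in> tangent_space \<A> p" for v
    proof -
      have "g p ?u v = (\<Sum>i\<in>UNIV. (v c $ i) * g p ?u (coord_vec \<A> c i p))"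
        using u by (intro linear_form_eq_sum[OF c v, of "g p ?u"]) (simp_all add: metric_add_right metric_scale_right)
      also have "\<dots> = \<xi> p v"
        unfolding * by (rule linear_form_eq_sum[OF c v, of "\<xi> p", symmetric]) (simp_all add: \<xi>_add \<xi>_scale)
      finally show ?thesis .
    qed
    with u(1) show ?thesis by blast
  qed
  \<comment> \<open>The pointwise statement does not mention the chart used to prove it, so
    \<open>Z\<close> is chosen on the whole manifold at once; smoothness is then checked chart by
    chart.\<close>
  then obtain Z where Z: "\<And>p. Z p \<in> tangent_space \<A> p"
    and gZ: "\<And>p v. v \<in> tangent_space \<A> p \<Longrightarrow> g p (Z p) v = \<xi> p v"
    by metis
  have "C_k_on k (chart_range c) (\<lambda>x. Z (chart_inv c x) c)" if c: "c \<in> \<A>" for k c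
  proof (rule C_k_on_vec_lambda[OF open_chart_range[OF c]])
    fix l
    let ?p = "chart_inv c"
    \<comment> \<open>The Gram matrix with column \<open>l\<close> replaced by the components of
      \<open>\<xi>\<close>: the numerator in Cramer's rule for component \<open>l\<close> of
      \<open>Z\<close>.\<close>
    let ?M = "\<lambda>x. \<chi> i j. if j = l then b c (?p x) $ i else gram c (?p x) $ i $ j"
    have Z_eq: "det (?M x) * inverse (det (gram c (?p x))) = Z (?p x) c $ l" if "x \<in> chart_range c" for x
    proof -
      have p: "?p x \<in> fst c" by (rule chart_inv_in[OF c that])
      have "gram c (?p x) *v Z (?p x) c = b c (?p x)"
        using gram_mult[OF c p Z] gZ[OF coord_vec_in_tangent_space[OF c p]]
        by (simp add: vec_eq_iff b_def)
      then show ?thesis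
        unfolding cramer[OF det_gram_nonzero[OF c p]] by (simp add: divide_inverse)
    qed
    have gC: "C_k_on k (chart_range c) (\<lambda>x. gram c (?p x) $ i $ j)" for i j
      using metric_C_k[OF c] by (simp add: gram_def)
    have bC: "C_k_on k (chart_range c) (\<lambda>x. b c (?p x) $ i)" for i
      using \<xi> c by (simp add: b_def one_forms_def smooth_on_def)
    have "C_k_on k (chart_range c) (\<lambda>x. ?M x $ i $ j)" for i j
      using gC[of i j] bC[of i] by (cases "j = l") simp_all
    then have "C_k_on k (chart_range c) (\<lambda>x. det (?M x) * inverse (det (gram c (?p x))))"
      using gC open_chart_range[OF c] det_gram_nonzero[OF c chart_inv_in[OF c]]
      by (intro C_k_on_mult C_k_on_inverse C_k_on_det)
    then show "C_k_on k (chart_range c) (\<lambda>x. Z (?p x) c $ l)"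
      by (rule C_k_on_cong[OF open_chart_range[OF c], THEN iffD1, rotated]) (rule Z_eq)
  qed
  with Z have "Z \<in> vector_fields \<A>" by (simp add: vector_fields_def smooth_on_def)
  moreover have "\<xi> = musical Z"
    by (intro ext) (simp add: musical_def gZ \<xi>_out)
  ultimately show thesis by (rule that)
qed

text \<open>Resolves the definite description, with uniqueness from \<open>musical_eqI\<close>.
  Separating \<open>Z\<close> from \<open>X\<close> serves both \<open>g\<close>, where
  \<open>Z = X\<close>, and the fundamental tensor, where \<open>Z = J X\<close>.\<close>

lemma flat_eq:
  assumes "Z \<in> vector_fields \<A>"
    and "\<And>Y. Y \<in> vector_fields \<A> \<Longrightarrow> b X Y = on_fields g Z Y"
  shows "flat \<A> b X = musical Z"
  unfolding flat_def
  by (rule the_equality) (use assms in \<open>auto simp: musical_in_one_forms form_app_musical intro: musical_eqI\<close>)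

lemma sharp_eq:
  assumes "inj_on (flat \<A> b) (vector_fields \<A>)" "X \<in> vector_fields \<A>" "flat \<A> b X = \<xi>"
  shows "sharp \<A> b \<xi> = X"
  using assms unfolding sharp_def by (auto intro: the_inv_into_f_eq)

text \<open>\<open>W\<close> is the \<open>g\<close>-adjoint of \<open>J\<close> applied to
  \<open>Z\<close>; exhibiting it as a field supplies existence in the definite description of the
  dual map.\<close>

lemma dual_map_musical:
  assumes "Z \<in> vector_fields \<A>" "W \<in> vector_fields \<A>"
    and "\<And>X. X \<in> vector_fields \<A> \<Longrightarrow> J X \<in> vector_fields \<A>"
    and "\<And>X. X \<in> vector_fields \<A> \<Longrightarrow> on_fields g Z (J X) = on_fields g W X"
  shows "dual_map \<A> J (musical Z) = musical W"
  unfolding dual_map_def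
  by (rule the_equality) (use assms in \<open>auto simp: musical_in_one_forms form_app_musical intro: musical_eqI\<close>)

end


section \<open>Almost complex structures compatible with a metric\<close>

lemma fscale_add: "fscale f (X + Y) = fscale f X + fscale f Y"
  by (simp add: fscale_def fun_eq_iff scaleR_add_right)

lemma fscale_minus: "fscale f (- X) = - fscale f X"
  by (simp add: fscale_def fun_eq_iff)

locale almost_complex_metric_atlas = metric_atlas \<A> g
  for \<A> :: "('a::{t2_space, second_countable_topology}, 'n::finite) chart set"
    and g :: "('a, 'n) tensor02" +
  fixes J :: "('a, 'n) vfield \<Rightarrow> ('a, 'n) vfield" and \<epsilon> :: real
  assumes endomorphism: "vfield_endomorphism \<A> J"
    and J_J: "X \<in> vector_fields \<A> \<Longrightarrow> J (J X) = - X"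
    and compatible: "X \<in> vector_fields \<A> \<Longrightarrow> Y \<in> vector_fields \<A> \<Longrightarrow>
      on_fields g (J X) (J Y) = \<epsilon> *\<^sub>R on_fields g X Y"
    and sign: "\<epsilon> \<in> {1, - 1}"
begin

lemma J_in: "X \<in> vector_fields \<A> \<Longrightarrow> J X \<in> vector_fields \<A>"
  and J_add: "X \<in> vector_fields \<A> \<Longrightarrow> Y \<in> vector_fields \<A> \<Longrightarrow> J (X + Y) = J X + J Y"
  and J_fscale: "f \<in> smooth_functions \<A> \<Longrightarrow> X \<in> vector_fields \<A> \<Longrightarrow> J (fscale f X) = fscale f (J X)"
  using endomorphism by (simp_all add: vfield_endomorphism_def)

lemma J_minus: "X \<in> vector_fields \<A> \<Longrightarrow> J (- X) = - J X"
  using J_fscale[OF smooth_functions_const, of X "- 1"] by (simp add: fscale_def fun_Compl_def)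

lemma inj_on_J: "inj_on J (vector_fields \<A>)"
  by (rule inj_onI) (metis J_J minus_minus)

lemma on_fields_scaleR_left:
  "X \<in> vector_fields \<A> \<Longrightarrow> Y \<in> vector_fields \<A> \<Longrightarrow> on_fields g (a *\<^sub>R X) Y = a *\<^sub>R on_fields g X Y"
  by (simp add: on_fields_def scaleR_fun_def[of a X] scaleR_fun_def[of a "\<lambda>p. g p (X p) (Y p)"]
      metric_scale_left vector_fields_in_tangent_space)

lemma on_fields_minus_right:
  "X \<in> vector_fields \<A> \<Longrightarrow> Y \<in> vector_fields \<A> \<Longrightarrow> on_fields g X (- Y) = - on_fields g X Y"
  using metric_scale_right[of "X p" p "Y p" "- 1" for p]
  by (simp add: on_fields_def fun_eq_iff vector_fields_in_tangent_space)

lemma on_fields_J_right: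
  assumes X: "X \<in> vector_fields \<A>" and Y: "Y \<in> vector_fields \<A>"
  shows "on_fields g X (J Y) = on_fields g ((- \<epsilon>) *\<^sub>R J X) Y"
proof -
  \<comment> \<open>Compatibility for the pair \<open>X\<close>, \<open>J Y\<close>, with
    \<open>J (J Y) = - Y\<close>. A further factor \<open>\<epsilon>\<close>, whose square is 1,
    then isolates the left side of the claim.\<close>
  have "\<epsilon> *\<^sub>R on_fields g X (J Y) = - on_fields g (J X) Y"
    using compatible[OF X J_in[OF Y]] by (simp add: J_J J_in X Y on_fields_minus_right)
  then have "\<epsilon> *\<^sub>R \<epsilon> *\<^sub>R on_fields g X (J Y) = (- \<epsilon>) *\<^sub>R on_fields g (J X) Y"
    by simp
  moreover have "\<epsilon> * \<epsilon> = 1" using sign by auto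
  ultimately show ?thesis
    using on_fields_scaleR_left[OF J_in[OF X] Y, of "- \<epsilon>"] by simp
qed

section \<open>Musical maps and the dual of \<open>J\<close> as operations on vector fields\<close>

lemma flat_metric: "X \<in> vector_fields \<A> \<Longrightarrow> flat \<A> (on_fields g) X = musical X"
  by (simp add: flat_eq)

lemma flat_fundamental:
  "X \<in> vector_fields \<A> \<Longrightarrow> flat \<A> (fundamental_tensor J g) X = musical (J X)"
  by (simp add: flat_eq J_in fundamental_tensor_def)

lemma sharp_metric:
  assumes "Z \<in> vector_fields \<A>"
  shows "sharp \<A> (on_fields g) (musical Z) = Z"
proof (rule sharp_eq)
  show "inj_on (flat \<A> (on_fields g)) (vector_fields \<A>)"
    using inj_on_musical by (simp add: flat_metric cong: inj_on_cong)
qed (simp_all add: assms flat_metric)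

text \<open>The preimage comes from \<open>flat_fundamental\<close> and
  \<open>J (- J Z) = Z\<close>; injectivity is inherited from \<open>J\<close> and
  \<open>musical\<close>.\<close>

lemma sharp_fundamental:
  assumes "Z \<in> vector_fields \<A>"
  shows "sharp \<A> (fundamental_tensor J g) (musical Z) = - J Z"
proof (rule sharp_eq)
  show "inj_on (flat \<A> (fundamental_tensor J g)) (vector_fields \<A>)"
  proof (rule inj_onI)
    fix X Y assume X: "X \<in> vector_fields \<A>" and Y: "Y \<in> vector_fields \<A>"
      and "flat \<A> (fundamental_tensor J g) X = flat \<A> (fundamental_tensor J g) Y"
    then have "musical (J X) = musical (J Y)" by (simp add: flat_fundamental)
    then show "X = Y"
      using inj_onD[OF inj_on_musical] inj_onD[OF inj_on_J] J_in X Y by blast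
  qed
qed (simp_all add: assms flat_fundamental J_in J_J J_minus vector_fields_minus)

lemma dual_map_J:
  "Z \<in> vector_fields \<A> \<Longrightarrow> dual_map \<A> J (musical Z) = musical ((- \<epsilon>) *\<^sub>R J Z)"
  by (intro dual_map_musical) (simp_all only: J_in vector_fields_scaleR on_fields_J_right)

section \<open>The block structures on pairs of vector fields\<close>

lemma ball_gsections:
  "(\<forall>s\<in>gsections \<A>. P s) \<longleftrightarrow> (\<forall>X\<in>vector_fields \<A>. \<forall>Z\<in>vector_fields \<A>. P (X, musical Z))"
proof -
  have "one_forms \<A> = musical ` vector_fields \<A>"
    using musical_in_one_forms one_form_eq_musical by blast
  then show ?thesis by (simp add: gsections_def)
qed

context
  fixes X Z assumes X: "X \<in> vector_fields \<A>" and Z: "Z \<in> vector_fields \<A>"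
begin

lemma musical_in_gsections: "(X, musical Z) \<in> gsections \<A>"
  using X Z by (simp add: gsections_def musical_in_one_forms)

lemma gen_J_metric: "gen_J \<A> (on_fields g) (X, musical Z) = (- Z, musical X)"
  using X Z by (simp add: gen_J_def block_map_def flat_metric sharp_metric flip: zero_fun_def)

lemma gen_F_metric: "gen_F \<A> (on_fields g) (X, musical Z) = (Z, musical X)"
  using X Z by (simp add: gen_F_def block_map_def flat_metric sharp_metric flip: zero_fun_def)

lemma gen_J_fundamental: "gen_J \<A> (fundamental_tensor J g) (X, musical Z) = (J Z, musical (J X))"
  using X Z by (simp add: gen_J_def block_map_def flat_fundamental sharp_fundamental flip: zero_fun_def)

lemma gen_F_fundamental: "gen_F \<A> (fundamental_tensor J g) (X, musical Z) = (- J Z, musical (J X))"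
  using X Z by (simp add: gen_F_def block_map_def flat_fundamental sharp_fundamental flip: zero_fun_def)

text \<open>The factor \<open>\<epsilon>\<close> meets the \<open>- \<epsilon>\<close> of
  \<open>dual_map_J\<close>, and their product is -1 for either sign; in
  \<open>gen_diag_minus\<close> the product is 1. Thus \<open>\<epsilon>\<close> disappears from the
  remaining calculations.\<close>

lemma gen_diag_plus: "gen_diag \<A> \<epsilon> J (X, musical Z) = (J X, musical (- J Z))"
  using X Z sign by (auto simp: gen_diag_def block_map_def dual_map_J musical_scaleR musical_minus J_in
      simp flip: zero_fun_def)

lemma gen_diag_minus: "gen_diag \<A> (- \<epsilon>) J (X, musical Z) = (J X, musical (J Z))"
  using X Z sign by (auto simp: gen_diag_def block_map_def dual_map_J musical_scaleR musical_minus J_in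
      simp flip: zero_fun_def)

end

lemmas gen_maps = gen_J_metric gen_F_metric gen_J_fundamental gen_F_fundamental
  gen_diag_plus gen_diag_minus

lemmas field_closure = vector_fields_add vector_fields_minus vector_fields_fscale J_in

text \<open>\<open>H\<close> and \<open>K\<close> are the components of \<open>P\<close> in terms of
  \<open>X\<close> and \<open>Z\<close>. Since \<open>musical\<close> respects sums and multiples by
  functions, the laws for \<open>P\<close> reduce to those for \<open>H\<close> and
  \<open>K\<close>.\<close>

lemma gen_endomorphismI:
  assumes P: "\<And>X Z. X \<in> vector_fields \<A> \<Longrightarrow> Z \<in> vector_fields \<A> \<Longrightarrow>
      P (X, musical Z) = (H X Z, musical (K X Z))"
    and closed: "\<And>X Z. X \<in> vector_fields \<A> \<Longrightarrow> Z \<in> vector_fields \<A> \<Longrightarrow>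
      H X Z \<in> vector_fields \<A> \<and> K X Z \<in> vector_fields \<A>"
    and add: "\<And>X Z Y W. X \<in> vector_fields \<A> \<Longrightarrow> Z \<in> vector_fields \<A> \<Longrightarrow>
      Y \<in> vector_fields \<A> \<Longrightarrow> W \<in> vector_fields \<A> \<Longrightarrow>
      H (X + Y) (Z + W) = H X Z + H Y W \<and> K (X + Y) (Z + W) = K X Z + K Y W"
    and scale: "\<And>f X Z. f \<in> smooth_functions \<A> \<Longrightarrow> X \<in> vector_fields \<A> \<Longrightarrow> Z \<in> vector_fields \<A> \<Longrightarrow>
      H (fscale f X) (fscale f Z) = fscale f (H X Z) \<and> K (fscale f X) (fscale f Z) = fscale f (K X Z)"
  shows "gen_endomorphism \<A> P"
  unfolding gen_endomorphism_def ball_gsections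
  by (simp add: P closed add scale musical_in_gsections vector_fields_add vector_fields_fscale
      flip: musical_add musical_fscale)

lemma gen_endomorphisms:
  "gen_endomorphism \<A> (gen_J \<A> (on_fields g))"
  "gen_endomorphism \<A> (\<lambda>s. - gen_F \<A> (on_fields g) s)"
  "gen_endomorphism \<A> (gen_F \<A> (on_fields g))"
  "gen_endomorphism \<A> (gen_J \<A> (fundamental_tensor J g))"
  "gen_endomorphism \<A> (gen_F \<A> (fundamental_tensor J g))"
  "gen_endomorphism \<A> (gen_diag \<A> \<epsilon> J)"
  "gen_endomorphism \<A> (gen_diag \<A> (- \<epsilon>) J)"
  \<comment> \<open>The first premise instantiates \<open>H\<close> and \<open>K\<close> from
    \<open>gen_maps\<close>. Reversing \<open>musical_minus\<close> moves the sign inside, so that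
    the negated map also has a second component of the form \<open>musical (K X Z)\<close>.\<close>
  by (rule gen_endomorphismI,
      (simp add: gen_maps musical_minus[symmetric]; fail),
      simp_all add: field_closure J_add J_fscale fscale_add fscale_minus)+

text \<open>On pairs the four products are \<open>(X, Z)\<close> to \<open>(J X, - J Z)\<close> to
  \<open>(J Z, J X)\<close>; to \<open>(J X, J Z)\<close> to \<open>(- J Z, J X)\<close>; to
  \<open>(J X, J Z)\<close> to \<open>(- Z, - X)\<close>; and to \<open>(- J Z, J X)\<close> to
  \<open>(J X, - J Z)\<close>. Squares and commutation are computed in the same way.\<close>

lemma generalized_triples:
  "gen_almost_hypercomplex \<A> (gen_J \<A> (on_fields g)) (gen_diag \<A> \<epsilon> J)
     (gen_J \<A> (fundamental_tensor J g))"
  "gen_almost_bicomplex \<A> (gen_J \<A> (on_fields g)) (gen_diag \<A> (- \<epsilon>) J)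
     (gen_F \<A> (fundamental_tensor J g))"
  "gen_almost_bicomplex \<A> (gen_J \<A> (fundamental_tensor J g)) (gen_diag \<A> (- \<epsilon>) J)
     (\<lambda>s. - gen_F \<A> (on_fields g) s)"
  "gen_almost_biparacomplex \<A> (gen_F \<A> (on_fields g)) (gen_F \<A> (fundamental_tensor J g))
     (gen_diag \<A> \<epsilon> J)"
  by (simp_all add: gen_almost_hypercomplex_def gen_almost_bicomplex_def gen_almost_biparacomplex_def
      gen_triple_structure_def gen_almost_product_def gen_almost_complex_def gcommute_def
      ganticommute_def gen_endomorphisms ball_gsections gen_maps field_closure J_J J_minus
      flip: musical_minus)

end

theorem proposition5p7:
  fixes \<A> :: "('a::{t2_space, second_countable_topology}, 'n::finite) chart set"
    and J :: "('a, 'n) vfield \<Rightarrow> ('a, 'n) vfield"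
    and g :: "('a, 'n) tensor02"
    and \<phi> :: "('a, 'n) bilin"
    and \<alpha> \<epsilon> :: real
  assumes "metric_manifold \<alpha> \<epsilon> \<A> J g"
    and "\<alpha> = - 1"
    and "\<phi> = fundamental_tensor J g"
  shows "gen_almost_hypercomplex \<A>
           (gen_J \<A> (on_fields g)) (gen_diag \<A> \<epsilon> J) (gen_J \<A> \<phi>) \<and>
         gen_almost_bicomplex \<A>
           (gen_J \<A> (on_fields g)) (gen_diag \<A> (- \<epsilon>) J) (gen_F \<A> \<phi>) \<and>
         gen_almost_bicomplex \<A>
           (gen_J \<A> \<phi>) (gen_diag \<A> (- \<epsilon>) J) (\<lambda>s. - gen_F \<A> (on_fields g) s) \<and>
         gen_almost_biparacomplex \<A>
           (gen_F \<A> (on_fields g)) (gen_F \<A> \<phi>) (gen_diag \<A> \<epsilon> J)"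
proof -
  interpret almost_complex_metric_atlas \<A> g J \<epsilon>
    using assms(1,2) by unfold_locales (auto simp: metric_manifold_def)
  show ?thesis using generalized_triples assms(3) by simp
qed

end
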